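(* Let $p\in(0,1)$. Suppose that $F\in \mathcal{F}^{+}_{1}$, and let $F_1,F_2,\ldots \in \mathcal{F}^{+}_{1}$ be any sequence of (possibly random) cdf's such that $$F_n^{-1}(p) \stackrel{\mathbb{P}}{\to} F^{-1}(p) \quad\text{and}\quad A_n\sup_{x\in \mathbb{R}} \big| F_n(x) - F(x)\big| =O_{\mathbb{P}}(1)$$ when $n\to \infty$, where $A_n\to \infty$ are some normalizing constants. Then $$A_n\left( \int_p^1 F_n^{-1}(u)\, du -\int_p^1 F^{-1}(u)\, du \right) =A_n\int^{\infty }_{F^{-1}(p)} \big( F(x)- F_n(x)\big)\, dx +o_{\mathbb{P}}(1)$$ and, therefore, for a random variable $\mathcal{L}(p)$, the convergence-in-distribution statement $$A_n\left( \int_p^1 F_n^{-1}(u)\, du -\int_p^1 F^{-1}(u)\, du \right) \stackrel{d}{\to} \mathcal{L}(p)$$ holds if and only if $$A_n\left( \int^{\infty }_{F^{-1}(p)} \big( 1- F_n(x)\big)\, dx -\int^{\infty }_{F^{-1}(p)} \big( 1- F(x)\big)\, dx \right)\stackrel{d}{\to} \mathcal{L}(p) .$$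
   Context: The quantile function of a cdf $F$ is $F^{-1}(u)=\inf\{x\in\mathbb{R}: F(x)\ge u\}$ for $u\in(0,1]$ and $F^{-1}(0)=\lim_{u\downarrow 0}F^{-1}(u)$. The class $\mathcal{F}^{+}_{1}$ consists of all (deterministic) cdf's $F$ for which $\int_p^1 F^{-1}(u)\,du$ is finite (for $p\in(0,1)$); equivalently, $\mathbb{E}(X^{+})<\infty$ for $X\sim F$, where $X^{+}=X\vee 0$. The cdf $F$ and the constants $A_n$ are deterministic. The $F_n$ may be random: on an underlying probability space $(\Omega,\mathcal{A},\mathbb{P})$, $F_n:\Omega\times\mathbb{R}\to[0,1]$ is jointly measurable and $F_n(\omega,\cdot)$ is a cdf for almost all $\omega$; $F_n\in\mathcal{F}^{+}_{1}$ means that $F_n(\omega,\cdot)\in\mathcal{F}^{+}_{1}$ for almost all $\omega$. No particular sampling design or dependence structure is assumed. $\stackrel{\mathbb{P}}{\to}$ and $\stackrel{d}{\to}$ denote convergence in probability and in distribution; $O_{\mathbb{P}}(1)$ and $o_{\mathbb{P}}(1)$ denote boundedness in probability and convergence to $0$ in probability as $n\to\infty$. *)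

theory Defs
  imports "HOL-Probability.Probability"
begin

definition is_cdf :: "(real \<Rightarrow> real) \<Rightarrow> bool" where
  "is_cdf F \<longleftrightarrow> (\<exists>\<mu>. real_distribution \<mu> \<and> F = cdf \<mu>)"

(* Extended-real valued: the quantile function of a cdf is finite on {0<..<1}, but it may be
   -\<infinity> at 0 and \<infinity> at 1 (infimum of the empty set).  Only u in {0..1} is meaningful. *)
definition quantile :: "(real \<Rightarrow> real) \<Rightarrow> real \<Rightarrow> ereal" where
  "quantile F u =
     (if u = 0 then Lim (at_right 0) (\<lambda>v. INF x\<in>{x. v \<le> F x}. ereal x)
      else INF x\<in>{x. u \<le> F x}. ereal x)"

definition F1_plus :: "(real \<Rightarrow> real) set" where
  "F1_plus = {F. is_cdf F \<and>
     (\<forall>p\<in>{0<..<1}.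
        interval_lebesgue_integrable lborel (ereal p) 1 (\<lambda>u. real_of_ereal (quantile F u)))}"

(* The three modes below require the X n to be random variables: the measure of a
   non-measurable set is 0 by convention, so that the conditions would otherwise be
   vacuously satisfiable. *)

definition tendsto_in_prob :: "'a measure \<Rightarrow> (nat \<Rightarrow> 'a \<Rightarrow> real) \<Rightarrow> real \<Rightarrow> bool" where
  "tendsto_in_prob M X c \<longleftrightarrow>
     (\<forall>n. X n \<in> borel_measurable M) \<and>
     (\<forall>e>0. (\<lambda>n. measure M {\<omega>\<in>space M. \<bar>X n \<omega> - c\<bar> > e}) \<longlonglongrightarrow> 0)"

definition bounded_in_prob :: "'a measure \<Rightarrow> (nat \<Rightarrow> 'a \<Rightarrow> real) \<Rightarrow> bool" where
  "bounded_in_prob M X \<longleftrightarrow>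
     (\<forall>n. X n \<in> borel_measurable M) \<and>
     (\<forall>e>0. \<exists>K. \<forall>\<^sub>F n in sequentially. measure M {\<omega>\<in>space M. \<bar>X n \<omega>\<bar> > K} \<le> e)"

definition tendsto_in_distr ::
    "'a measure \<Rightarrow> (nat \<Rightarrow> 'a \<Rightarrow> real) \<Rightarrow> 'b measure \<Rightarrow> ('b \<Rightarrow> real) \<Rightarrow> bool" where
  "tendsto_in_distr M X N L \<longleftrightarrow>
     (\<forall>n. X n \<in> borel_measurable M) \<and>
     weak_conv_m (\<lambda>n. distr M borel (X n)) (distr N borel L)"

(* Standing assumptions on a random cdf.  The function G \<omega> is a cdf only for almost all \<omega>, so
   functionals such as its quantiles or its uniform distance to a fixed cdf are in general
   measurable only with respect to the completion of M; the modes of convergence above are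
   therefore to be applied to "completion M". *)
definition random_cdf_F1_plus :: "'a measure \<Rightarrow> ('a \<Rightarrow> real \<Rightarrow> real) \<Rightarrow> bool" where
  "random_cdf_F1_plus M G \<longleftrightarrow>
     (\<lambda>(\<omega>, x). G \<omega> x) \<in> borel_measurable (M \<Otimes>\<^sub>M borel) \<and>
     (\<forall>\<omega>\<in>space M. \<forall>x. G \<omega> x \<in> {0..1}) \<and>
     (AE \<omega> in M. G \<omega> \<in> F1_plus)"

end

theory Submission
  imports Defs
begin

text \<open>Write \<open>q = F\<^sup>-\<^sup>1(p)\<close> and \<open>q\<^sub>n = F\<^sub>n\<^sup>-\<^sup>1(p)\<close>.  Integrating the region above the graph of a cdf
  \<open>G\<close> in both directions, the integral of \<open>G\<^sup>-\<^sup>1\<close> over \<open>(p, 1)\<close> is \<open>(1 - p) G\<^sup>-\<^sup>1(p)\<close> plus the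
  integral of \<open>1 - G\<close> over \<open>(G\<^sup>-\<^sup>1(p), \<infinity>)\<close>.  Applied to \<open>F\<close> and \<open>F\<^sub>n\<close>, this shows that the
  linearization error is exactly \<open>A\<^sub>n\<close> times the integral of \<open>F\<^sub>n - p\<close> from \<open>q\<close> to \<open>q\<^sub>n\<close>.  Between
  \<open>q\<close> and \<open>q\<^sub>n\<close> the level \<open>p\<close> separates \<open>F\<close> from \<open>F\<^sub>n\<close>, so the error is at most
  \<open>\<bar>q\<^sub>n - q\<bar> A\<^sub>n sup \<bar>F\<^sub>n - F\<bar>\<close>, a null sequence in probability times a bounded one.  The
  equivalence of the two distributional limits is then Slutsky's lemma.\<close>

section \<open>Quantiles as pseudoinverses of cdfs\<close>

abbreviation rquantile :: "(real \<Rightarrow> real) \<Rightarrow> real \<Rightarrow> real" where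
  "rquantile F u \<equiv> real_of_ereal (quantile F u)"

lemma is_cdf_right_continuous_mono:
  assumes "is_cdf F"
  shows "right_continuous_mono F 0 1"
proof -
  obtain \<mu> where \<mu>: "real_distribution \<mu>" "F = cdf \<mu>"
    using assms by (auto simp: is_cdf_def)
  interpret cdf_distribution \<mu>
    using \<mu>(1) by (simp add: cdf_distribution_def)
  show ?thesis
    unfolding \<mu>(2) by (rule right_continuous_mono_axioms)
qed

lemma is_cdf_range:
  assumes "is_cdf F"
  shows "0 \<le> F x" "F x \<le> 1"
proof -
  obtain \<mu> where \<mu>: "real_distribution \<mu>" "F = cdf \<mu>"
    using assms by (auto simp: is_cdf_def)
  interpret real_distribution \<mu> by fact
  show "0 \<le> F x" "F x \<le> 1"
    unfolding \<mu>(2) by (auto simp: cdf_nonneg cdf_bounded_prob)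
qed

lemma is_cdf_borel:
  assumes "is_cdf F"
  shows "F \<in> borel_measurable borel"
  using right_continuous_mono.mono[OF is_cdf_right_continuous_mono[OF assms]]
  by (rule borel_measurable_mono)

text \<open>Right continuity makes the infimum attained for levels strictly between 0 and 1, so the
  extended-real infimum is finite and agrees with the real pseudoinverse \<open>I\<close>.\<close>

lemma quantile_eq_Inf:
  assumes "is_cdf F" "0 < u" "u < 1"
  shows "quantile F u = ereal (Inf {x. u \<le> F x})"
proof -
  interpret right_continuous_mono F 0 1
    by (rule is_cdf_right_continuous_mono) fact
  have "(INF x\<in>{x. u \<le> F x}. ereal x) = ereal (I u)"
  proof (rule antisym)
    show "(INF x\<in>{x. u \<le> F x}. ereal x) \<le> ereal (I u)"
      using pseudoinverse[OF assms(2,3), of "I u"] by (intro INF_lower) auto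
    show "ereal (I u) \<le> (INF x\<in>{x. u \<le> F x}. ereal x)"
    proof (rule INF_greatest)
      fix x assume "x \<in> {x. u \<le> F x}"
      then show "ereal (I u) \<le> ereal x"
        using pseudoinverse[OF assms(2,3), of x] by simp
    qed
  qed
  then show ?thesis
    using assms(2) by (simp add: quantile_def)
qed

lemma ereal_rquantile:
  assumes "is_cdf F" "0 < u" "u < 1"
  shows "quantile F u = ereal (rquantile F u)"
  using quantile_eq_Inf[OF assms] by simp

text \<open>The Galois connection between a cdf and its quantile function. Later arguments use
  quantiles only through this equivalence, never through infima.\<close>

lemma rquantile_le_iff:
  assumes "is_cdf F" "0 < u" "u < 1"
  shows "rquantile F u \<le> x \<longleftrightarrow> u \<le> F x"
proof -
  interpret right_continuous_mono F 0 1
    by (rule is_cdf_right_continuous_mono) fact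
  show ?thesis
    using quantile_eq_Inf[OF assms] pseudoinverse[OF assms(2,3), of x] by simp
qed

section \<open>Tail integrals of quantile functions and of cdfs\<close>

lemma F1_plusD:
  assumes "F \<in> F1_plus" "0 < p" "p < 1"
  shows "is_cdf F" "set_integrable lborel {p<..<1} (rquantile F)"
  using assms
  by (auto simp: F1_plus_def interval_lebesgue_integrable_def one_ereal_def)

text \<open>By Tonelli: since \<open>x < F\<^sup>-\<^sup>1(u)\<close> iff \<open>F(x) < u\<close>, the two integrals measure the region
  \<open>E\<close> above the graph of \<open>F\<close> by horizontal and by vertical sections.\<close>

lemma quantile_tail:
  assumes F: "is_cdf F" and p: "0 < p" "p < 1"
    and int: "set_integrable lborel {p<..<1} (rquantile F)"
  defines "q \<equiv> rquantile F p"
  shows "set_integrable lborel {q<..} (\<lambda>x. 1 - F x)"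
    and "(LBINT u:{p<..<1}. rquantile F u) = (1 - p) * q + (LBINT x:{q<..}. 1 - F x)"
proof -
  note [measurable] = is_cdf_borel[OF F]
  define E where "E = {(u, x). p < u \<and> u < 1 \<and> q < x \<and> F x < u}"
  have [measurable]: "E \<in> sets (lborel \<Otimes>\<^sub>M lborel)"
  proof -
    have "E = {z \<in> space (lborel \<Otimes>\<^sub>M lborel). p < fst z \<and> fst z < 1 \<and> q < snd z \<and> F (snd z) < fst z}"
      by (auto simp: E_def space_pair_measure)
    also have "\<dots> \<in> sets (lborel \<Otimes>\<^sub>M lborel)"
      by measurable
    finally show ?thesis .
  qed
  \<comment> \<open>These are the lengths of the sections of \<open>E\<close> at fixed
    \<open>u\<close> and at fixed \<open>x\<close>. Subtracting \<open>q\<close> makes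
    \<open>g\<close> nonnegative, as Tonelli requires; it returns at the end as the term
    \<open>(1 - p) * q\<close>.\<close>
  define g where "g = (\<lambda>u::real. indicator {p<..<1} u * (rquantile F u - q))"
  define h where "h = (\<lambda>x::real. indicator {q<..} x * (1 - F x))"
  have g_int: "integrable lborel g"
  proof -
    have "set_integrable lborel {p<..<1} (\<lambda>u. rquantile F u - q)"
      using int p by (intro set_integral_diff) (auto simp: set_integrable_def)
    then show ?thesis by (simp add: set_integrable_def g_def)
  qed
  have g_nonneg: "0 \<le> g u" for u
  proof (cases "p < u \<and> u < 1")
    case True
    then have "u \<le> F (rquantile F u)"
      using rquantile_le_iff[OF F, of u "rquantile F u"] p by simp
    then have "q \<le> rquantile F u"
      unfolding q_def using rquantile_le_iff[OF F p] True by simp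
    then show ?thesis by (simp add: g_def)
  qed (auto simp: g_def)
  have h_nonneg: "0 \<le> h x" for x
    using is_cdf_range[OF F] by (simp add: h_def)
  have g_eq: "(\<integral>\<^sup>+x. indicator E (u, x) \<partial>lborel) = ennreal (g u)" for u
  proof (cases "p < u \<and> u < 1")
    case True
    then have "(\<lambda>x. indicator E (u, x) :: ennreal) = indicator {q<..<rquantile F u}"
      using rquantile_le_iff[OF F, of u] p
      by (auto simp: E_def indicator_def fun_eq_iff not_le[symmetric])
    then show ?thesis
      using True g_nonneg[of u] by (simp add: g_def)
  qed (auto simp: g_def E_def)
  have h_eq: "(\<integral>\<^sup>+u. indicator E (u, x) \<partial>lborel) = ennreal (h x)" for x
  proof (cases "q < x")
    case True
    \<comment> \<open>To the right of \<open>q\<close> the constraint \<open>p < u\<close> already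
      follows from \<open>F x < u\<close>, so the section is the whole interval from
      \<open>F x\<close> to 1.\<close>
    then have "p \<le> F x"
      using rquantile_le_iff[OF F p, of x] by (simp add: q_def)
    then have "(\<lambda>u. indicator E (u, x) :: ennreal) = indicator {F x<..<1}"
      using True by (auto simp: E_def indicator_def fun_eq_iff)
    then show ?thesis
      using True is_cdf_range[OF F] by (simp add: h_def)
  qed (auto simp: h_def E_def)
  have eq: "(\<integral>\<^sup>+u. g u \<partial>lborel) = (\<integral>\<^sup>+x. h x \<partial>lborel)"
    using lborel_pair.Fubini'[of "\<lambda>u x. indicator E (u, x)"]
    by (simp add: g_eq h_eq)
  \<comment> \<open>Finiteness passes from \<open>g\<close> to \<open>h\<close> because both
    integrals equal the area of \<open>E\<close>.\<close>
  have h_int: "integrable lborel h"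
  proof (rule integrableI_nonneg)
    show "h \<in> borel_measurable lborel" by (simp add: h_def)
    show "(\<integral>\<^sup>+x. h x \<partial>lborel) < \<infinity>"
      using g_int g_nonneg by (simp add: eq[symmetric] integrable_iff_bounded)
  qed (auto simp: h_nonneg)
  then show "set_integrable lborel {q<..} (\<lambda>x. 1 - F x)"
    by (simp add: set_integrable_def h_def)
  have "integral\<^sup>L lborel g = integral\<^sup>L lborel h"
    using g_int h_int g_nonneg h_nonneg eq by (simp add: integral_eq_nn_integral)
  moreover have "integral\<^sup>L lborel g = (LBINT u:{p<..<1}. rquantile F u) - (LBINT u:{p<..<1}. q)"
    using int p by (subst set_integral_diff(2)[symmetric])
      (auto simp: set_integrable_def set_lebesgue_integral_def g_def)
  moreover have "(LBINT u:{p<..<1}. q) = (1 - p) * q"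
    using p by (simp add: set_lebesgue_integral_def)
  ultimately show "(LBINT u:{p<..<1}. rquantile F u) = (1 - p) * q + (LBINT x:{q<..}. 1 - F x)"
    unfolding set_lebesgue_integral_def h_def by (simp only: real_scaleR_def)
qed

text \<open>Right of the median this is \<open>quantile_tail\<close>; on the remaining bounded
  interval the integrand lies between 0 and 1. An arbitrary left endpoint is allowed because the
  tail of each random cdf is also integrated from the quantile of \<open>F\<close>.\<close>

lemma set_integrable_cdf_tail:
  assumes "F \<in> F1_plus"
  shows "set_integrable lborel {a<..} (\<lambda>x. 1 - F x)"
proof -
  have F: "is_cdf F" and "set_integrable lborel {1/2<..<1} (rquantile F)"
    using F1_plusD[OF assms, of "1/2"] by auto
  note [measurable] = is_cdf_borel[OF F]
  define q where "q = rquantile F (1/2)"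
  have "set_integrable lborel {q<..} (\<lambda>x. 1 - F x)"
    unfolding q_def by (rule quantile_tail) (fact | simp)+
  moreover have "set_integrable lborel {a..q} (\<lambda>x. 1 - F x)"
    unfolding set_integrable_def
    using is_cdf_range[OF F]
    by (intro integrableI_bounded_set[where A="{a..q}" and B=1])
      (auto split: split_indicator simp: emeasure_lborel_Icc_eq)
  ultimately have "set_integrable lborel ({a..q} \<union> {q<..}) (\<lambda>x. 1 - F x)"
    by (intro set_integrable_Un) auto
  then show ?thesis
    by (rule set_integrable_subset) auto
qed

text \<open>Subtracting the tail identities of the two cdfs leaves only an integral of
  \<open>G x - p\<close> between the two quantiles, where \<open>p\<close> lies between the values
  of \<open>F\<close> and \<open>G\<close>.\<close>

lemma quantile_integral_linearization:
  assumes F: "F \<in> F1_plus" and G: "G \<in> F1_plus" and p: "0 < p" "p < 1"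
    and S: "\<And>x. \<bar>G x - F x\<bar> \<le> S"
  defines "q \<equiv> rquantile F p" and "r \<equiv> rquantile G p"
  shows "\<bar>((LBINT u:{p<..<1}. rquantile G u) - (LBINT u:{p<..<1}. rquantile F u))
           - ((LBINT x:{q<..}. 1 - G x) - (LBINT x:{q<..}. 1 - F x))\<bar> \<le> \<bar>r - q\<bar> * S"
proof -
  note Fc = F1_plusD[OF F p] and Gc = F1_plusD[OF G p]
  have [measurable]: "G \<in> borel_measurable borel"
    using is_cdf_borel Gc(1) by blast
  have F_iff: "q \<le> x \<longleftrightarrow> p \<le> F x" and G_iff: "r \<le> x \<longleftrightarrow> p \<le> G x" for x
    using rquantile_le_iff[OF Fc(1) p] rquantile_le_iff[OF Gc(1) p] by (auto simp: q_def r_def)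
  \<comment> \<open>Oriented interval integrals let the tail of \<open>G\<close> be split at
    \<open>r\<close> whichever of \<open>q\<close> and \<open>r\<close> is larger.\<close>
  have "(LBINT x=q..r. 1 - G x) + (LBINT x=r..\<infinity>. 1 - G x) = (LBINT x=q..\<infinity>. 1 - G x)"
    using set_integrable_cdf_tail[OF G]
    by (intro interval_integral_sum) (auto simp: interval_lebesgue_integrable_def min_def)
  then have "((LBINT u:{p<..<1}. rquantile G u) - (LBINT u:{p<..<1}. rquantile F u))
           - ((LBINT x:{q<..}. 1 - G x) - (LBINT x:{q<..}. 1 - F x))
       = (1 - p) * (r - q) - (LBINT x=q..r. 1 - G x)"
    using quantile_tail(2)[OF Fc(1) p Fc(2)] quantile_tail(2)[OF Gc(1) p Gc(2)]
    by (simp add: q_def r_def interval_integral_to_infinity_eq algebra_simps)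
  \<comment> \<open>The product \<open>(1 - p) * (r - q)\<close> becomes the integral of a constant,
    so that the integrand is \<open>G x - p\<close>.\<close>
  also have "\<dots> = (LBINT x=q..r. (1 - p) - (1 - G x))"
  proof -
    have "set_integrable lborel {a<..<b} (\<lambda>x. 1 - G x)" for a b
      using set_integrable_cdf_tail[OF G, of a] by (rule set_integrable_subset) auto
    then have "interval_lebesgue_integrable lborel (ereal q) (ereal r) (\<lambda>x. 1 - G x)"
      by (simp add: interval_lebesgue_integrable_def)
    from interval_lebesgue_integral_diff(2)[OF interval_integral_const(1) this, of "1 - p"]
    show ?thesis by simp
  qed
  also have "\<bar>\<dots>\<bar> \<le> \<bar>r - q\<bar> * S"
  proof -
    have bound: "\<bar>LBINT x:{a<..<b}. (1 - p) - (1 - G x)\<bar> \<le> \<bar>b - a\<bar> * S"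
      if "a \<le> b" "\<And>x. a < x \<Longrightarrow> x < b \<Longrightarrow> \<bar>G x - p\<bar> \<le> S" for a b
    proof -
      have "\<bar>LBINT x:{a<..<b}. (1 - p) - (1 - G x)\<bar> \<le> (LINT x|lborel. indicator {a<..<b} x * S)"
        unfolding set_lebesgue_integral_def real_norm_def[symmetric]
      proof (rule Bochner_Integration.integral_norm_bound_integral)
        show "integrable lborel (\<lambda>x. indicator {a<..<b} x *\<^sub>R (1 - p - (1 - G x)))"
          using that(2)
          by (intro integrableI_bounded_set[where A="{a<..<b}" and B=S])
            (auto split: split_indicator simp: abs_minus_commute that(1))
        show "integrable lborel (\<lambda>x. indicator {a<..<b} x * S)"
          using that(1) by (simp add: integrable_indicator_iff)
      qed (use that(2) in \<open>auto split: split_indicator\<close>)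
      then show ?thesis using that(1) by simp
    qed
    show ?thesis
    proof (cases "q \<le> r")
      case True
      \<comment> \<open>Here \<open>G x < p\<close> and \<open>p \<le> F x\<close>, so the distance
        from \<open>G x\<close> to \<open>p\<close> is at most that from \<open>G x\<close> to
        \<open>F x\<close>. In the other case the inequalities are reversed.\<close>
      have "\<bar>G x - p\<bar> \<le> S" if "q < x" "x < r" for x
        using that F_iff[of x] G_iff[of x] S[of x] by simp
      with True bound[of q r] show ?thesis
        by (simp add: interval_lebesgue_integral_le_eq)
    next
      case False
      have "\<bar>G x - p\<bar> \<le> S" if "r < x" "x < q" for x
        using that F_iff[of x] G_iff[of x] S[of x] by simp
      with False bound[of r q] show ?thesis
        by (simp add: interval_lebesgue_integral_gt_eq abs_minus_commute)
    qed
  qed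
  finally show ?thesis .
qed


section \<open>Convergence in probability and in distribution\<close>

lemma (in complete_measure) borel_measurable_cong_AE:
  assumes "f \<in> borel_measurable M" "AE x in M. f x = g x"
  shows "g \<in> borel_measurable M"
proof (rule measurableI)
  fix S :: "'b set" assume S: "S \<in> sets borel"
  \<comment> \<open>The preimages under \<open>f\<close> and \<open>g\<close> agree up to a null
    set, which completeness absorbs.\<close>
  show "g -` S \<inter> space M \<in> sets M"
  proof (rule in_sets_AE)
    show "AE x in M. x \<in> f -` S \<inter> space M \<longleftrightarrow> x \<in> g -` S \<inter> space M"
      using assms(2) by eventually_elim auto
  qed (use measurable_sets[OF assms(1) S] in auto)
qed auto

text \<open>If the product exceeds \<open>e\<close>, then either the bounded factor exceeds its
  threshold or the vanishing factor exceeds \<open>e / K\<close>. Both events have small probability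
  for large \<open>n\<close>.\<close>

lemma tendsto_in_prob_mult_bounded:
  assumes "prob_space M"
    and U: "tendsto_in_prob M U c" and V: "bounded_in_prob M V"
    and Z: "\<And>n. Z n \<in> borel_measurable M"
    and le: "\<And>n. AE \<omega> in M. \<bar>Z n \<omega>\<bar> \<le> \<bar>U n \<omega> - c\<bar> * \<bar>V n \<omega>\<bar>"
  shows "tendsto_in_prob M Z 0"
  unfolding tendsto_in_prob_def
proof (intro conjI allI impI Z)
  interpret prob_space M by fact
  have [measurable]: "U n \<in> borel_measurable M" "V n \<in> borel_measurable M"
      "Z n \<in> borel_measurable M" for n
    using U V Z by (auto simp: tendsto_in_prob_def bounded_in_prob_def)
  fix e :: real assume e: "0 < e"
  show "(\<lambda>n. prob {\<omega>\<in>space M. \<bar>Z n \<omega> - 0\<bar> > e}) \<longlonglongrightarrow> 0"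
  proof (rule LIMSEQ_I)
    fix d :: real assume d: "0 < d"
    then obtain K0 where K0: "\<forall>\<^sub>F n in sequentially. prob {\<omega>\<in>space M. \<bar>V n \<omega>\<bar> > K0} \<le> d/3"
      using V[unfolded bounded_in_prob_def, THEN conjunct2, rule_format, of "d/3"] by auto
    \<comment> \<open>The threshold \<open>K0\<close> may be zero or negative; \<open>K\<close> is
      positive, so division by it is safe.\<close>
    define K where "K = max K0 1"
    have K: "0 < K" "K0 \<le> K" by (auto simp: K_def)
    have "(\<lambda>n. prob {\<omega>\<in>space M. \<bar>U n \<omega> - c\<bar> > e / K}) \<longlonglongrightarrow> 0"
      using U e K by (auto simp: tendsto_in_prob_def)
    then have "\<forall>\<^sub>F n in sequentially. prob {\<omega>\<in>space M. \<bar>U n \<omega> - c\<bar> > e / K} < d/3"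
      using d by (intro order_tendstoD(2)[of _ 0]) auto
    with K0 have "\<forall>\<^sub>F n in sequentially. norm (prob {\<omega>\<in>space M. \<bar>Z n \<omega> - 0\<bar> > e} - 0) < d"
    proof eventually_elim
      case (elim n)
      have "prob {\<omega>\<in>space M. \<bar>Z n \<omega> - 0\<bar> > e}
          \<le> prob ({\<omega>\<in>space M. \<bar>V n \<omega>\<bar> > K0} \<union> {\<omega>\<in>space M. \<bar>U n \<omega> - c\<bar> > e / K})"
      proof (rule finite_measure_mono_AE)
        show "AE \<omega> in M. \<omega> \<in> {\<omega>\<in>space M. \<bar>Z n \<omega> - 0\<bar> > e} \<longrightarrow>
           \<omega> \<in> {\<omega>\<in>space M. \<bar>V n \<omega>\<bar> > K0} \<union> {\<omega>\<in>space M. \<bar>U n \<omega> - c\<bar> > e / K}"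
          using le[of n]
        proof eventually_elim
          case (elim \<omega>)
          have "e / K < \<bar>U n \<omega> - c\<bar>" if "e < \<bar>Z n \<omega>\<bar>" "\<not> K0 < \<bar>V n \<omega>\<bar>"
          proof -
            from that have "e < \<bar>U n \<omega> - c\<bar> * K"
              using elim K mult_left_mono[of "\<bar>V n \<omega>\<bar>" K "\<bar>U n \<omega> - c\<bar>"] by linarith
            then show ?thesis using K by (simp add: field_simps)
          qed
          then show ?case by auto
        qed
      qed measurable
      also have "\<dots> \<le> prob {\<omega>\<in>space M. \<bar>V n \<omega>\<bar> > K0} + prob {\<omega>\<in>space M. \<bar>U n \<omega> - c\<bar> > e / K}"
        by (rule measure_Un_le) measurable
      also have "\<dots> < d" using elim d by linarith
      finally show ?case by simp
    qed
    then show "\<exists>no. \<forall>n\<ge>no. norm (prob {\<omega>\<in>space M. \<bar>Z n \<omega> - 0\<bar> > e} - 0) < d"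
      by (simp add: eventually_sequentially)
  qed
qed

text \<open>The Lipschitz bound serves where the arguments are close, the crude bound on the
  exceptional event where they are not.\<close>

lemma cmod_iexp_diff_le:
  "cmod (iexp x - iexp y) \<le> \<bar>x - y\<bar>" "cmod (iexp x - iexp y) \<le> 2"
proof -
  have "cmod (iexp x - iexp y) = cmod (iexp y * (iexp (x - y) - 1))"
    by (simp add: algebra_simps flip: exp_add)
  also have "\<dots> \<le> \<bar>x - y\<bar>"
    using iexp_approx1[of "x - y" 0] by (simp add: norm_mult)
  finally show "cmod (iexp x - iexp y) \<le> \<bar>x - y\<bar>" .
  show "cmod (iexp x - iexp y) \<le> 2"
    using norm_triangle_ineq4[of "iexp x" "iexp y"] by simp
qed

lemma tendsto_char_diff:
  assumes "prob_space M"
    and X: "\<And>n. X n \<in> borel_measurable M" and Y: "\<And>n. Y n \<in> borel_measurable M"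
    and D: "tendsto_in_prob M (\<lambda>n \<omega>. X n \<omega> - Y n \<omega>) 0"
  shows "(\<lambda>n. char (distr M borel (X n)) t - char (distr M borel (Y n)) t) \<longlonglongrightarrow> 0"
proof (rule LIMSEQ_I)
  interpret prob_space M by fact
  note [measurable] = X Y
  fix e :: real assume e: "0 < e"
  \<comment> \<open>Close values then contribute at most \<open>e / 2\<close>, and the bound
    \<open>e / 4\<close> on the probability of \<open>B n\<close>, doubled, supplies the other half.
    Adding 1 covers \<open>t = 0\<close>.\<close>
  define d where "d = e / (2 * (\<bar>t\<bar> + 1))"
  have d: "0 < d" "\<bar>t\<bar> * d \<le> e / 2"
    using e by (auto simp: d_def field_simps)
  define B where "B n = {\<omega>\<in>space M. \<bar>X n \<omega> - Y n \<omega> - 0\<bar> > d}" for n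
  have [measurable]: "B n \<in> sets M" for n unfolding B_def by measurable
  have "(\<lambda>n. prob (B n)) \<longlonglongrightarrow> 0"
    using D d by (simp add: tendsto_in_prob_def B_def)
  then have "\<forall>\<^sub>F n in sequentially. prob (B n) < e / 4"
    using e by (intro order_tendstoD(2)[of _ 0]) auto
  then have "\<forall>\<^sub>F n in sequentially.
      norm (char (distr M borel (X n)) t - char (distr M borel (Y n)) t - 0) < e"
  proof eventually_elim
    case (elim n)
    have int: "integrable M (\<lambda>\<omega>. iexp (t * X n \<omega>))" "integrable M (\<lambda>\<omega>. iexp (t * Y n \<omega>))"
      by (rule integrable_iexp; simp)+
    have ind: "integrable M (\<lambda>\<omega>. 2 * indicator (B n) \<omega> :: real)"
      by (intro integrable_mult_right integrable_real_indicator) (auto simp: less_top[symmetric])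
    have "char (distr M borel (X n)) t - char (distr M borel (Y n)) t
        = (CLINT \<omega>|M. iexp (t * X n \<omega>) - iexp (t * Y n \<omega>))"
      using int by (simp add: char_def integral_distr)
    also have "norm \<dots> \<le> (LINT \<omega>|M. \<bar>t\<bar> * d + 2 * indicator (B n) \<omega>)"
    proof (rule order_trans[OF integral_norm_bound integral_mono])
      fix \<omega> assume "\<omega> \<in> space M"
      show "norm (iexp (t * X n \<omega>) - iexp (t * Y n \<omega>)) \<le> \<bar>t\<bar> * d + 2 * indicator (B n) \<omega>"
      proof (cases "\<omega> \<in> B n")
        case True
        have "0 \<le> \<bar>t\<bar> * d" using d by simp
        with True show ?thesis
          using cmod_iexp_diff_le(2)[of "t * X n \<omega>" "t * Y n \<omega>"] by simp
      next
        case False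
        then have "\<bar>t\<bar> * \<bar>X n \<omega> - Y n \<omega>\<bar> \<le> \<bar>t\<bar> * d"
          using \<open>\<omega> \<in> space M\<close> by (intro mult_left_mono) (auto simp: B_def)
        with False show ?thesis
          using cmod_iexp_diff_le(1)[of "t * X n \<omega>" "t * Y n \<omega>"]
          by (simp add: abs_mult[symmetric] right_diff_distrib)
      qed
    qed (use int ind in auto)
    also have "\<dots> = \<bar>t\<bar> * d + 2 * prob (B n)"
      using ind by (simp add: prob_space)
    also have "\<dots> < e" using elim d by linarith
    finally show ?case by simp
  qed
  then show "\<exists>no. \<forall>n\<ge>no. norm (char (distr M borel (X n)) t - char (distr M borel (Y n)) t - 0) < e"
    by (simp add: eventually_sequentially)
qed

text \<open>By Levy's theorem it suffices to pass to the limit in characteristic functions, and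
  those of \<open>X n\<close> and \<open>Y n\<close> differ by a null sequence.\<close>

lemma tendsto_in_distr_slutsky:
  assumes M: "prob_space M" and N: "prob_space N" "L \<in> borel_measurable N"
    and Y: "\<And>n. Y n \<in> borel_measurable M"
    and D: "tendsto_in_prob M (\<lambda>n \<omega>. X n \<omega> - Y n \<omega>) 0"
    and X: "tendsto_in_distr M X N L"
  shows "tendsto_in_distr M Y N L"
  unfolding tendsto_in_distr_def
proof (intro conjI allI Y levy_continuity)
  have X': "X n \<in> borel_measurable M" for n
    using X by (simp add: tendsto_in_distr_def)
  show "real_distribution (distr M borel (Y n))" for n
    by (rule prob_space.real_distribution_distr[OF M Y])
  show L: "real_distribution (distr N borel L)"
    by (rule prob_space.real_distribution_distr[OF N])
  fix t
  have "(\<lambda>n. char (distr M borel (X n)) t) \<longlonglongrightarrow> char (distr N borel L) t"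
    using X L prob_space.real_distribution_distr[OF M X']
    by (intro levy_continuity1) (auto simp: tendsto_in_distr_def)
  from tendsto_diff[OF this tendsto_char_diff[OF M X' Y D, of t]]
  show "(\<lambda>n. char (distr M borel (Y n)) t) \<longlonglongrightarrow> char (distr N borel L) t"
    by simp
qed

section \<open>Measurability of random tail integrals\<close>

lemma borel_measurable_cdf_tail:
  fixes G :: "'a \<Rightarrow> real \<Rightarrow> real" and r :: "'a \<Rightarrow> real"
  assumes "(\<lambda>(\<omega>, x). G \<omega> x) \<in> borel_measurable (M \<Otimes>\<^sub>M borel)"
    and [measurable]: "r \<in> borel_measurable M"
  shows "(\<lambda>\<omega>. LBINT x:{r \<omega><..}. 1 - G \<omega> x) \<in> borel_measurable M"
proof -
  have [measurable]: "(\<lambda>z. G (fst z) (snd z)) \<in> borel_measurable (M \<Otimes>\<^sub>M lborel)"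
    using assms(1) by (simp add: case_prod_unfold cong: measurable_cong_sets sets_pair_measure_cong)
  have [measurable]: "Measurable.pred (M \<Otimes>\<^sub>M lborel) (\<lambda>z. snd z \<in> {r (fst z)<..})"
    unfolding greaterThan_iff by measurable
  show ?thesis
    unfolding set_lebesgue_integral_def
    by (rule lborel.borel_measurable_lebesgue_integral) (unfold case_prod_unfold, measurable)
qed

text \<open>Completion only enlarges the sigma-algebra, so the identity from
  \<open>completion M\<close> to \<open>M\<close> is measurable and joint measurability pulls back
  along it.\<close>

lemma borel_measurable_pair_completion:
  assumes "f \<in> borel_measurable (M \<Otimes>\<^sub>M N)"
  shows "f \<in> borel_measurable (completion M \<Otimes>\<^sub>M N)"
proof -
  have "(\<lambda>z. (fst z, snd z)) \<in> completion M \<Otimes>\<^sub>M N \<rightarrow>\<^sub>M M \<Otimes>\<^sub>M N"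
    by (intro measurable_Pair measurable_snd
        measurable_compose[OF measurable_fst measurable_completion[OF measurable_ident_sets[OF refl]]])
  from measurable_compose[OF this assms] show ?thesis by simp
qed

section \<open>The linearization and the equivalence of the limits\<close>

theorem corollary3p3:
  fixes M :: "'a measure"
    and p :: real
    and F :: "real \<Rightarrow> real"
    and Fn :: "nat \<Rightarrow> 'a \<Rightarrow> real \<Rightarrow> real"
    and A :: "nat \<Rightarrow> real"
  assumes "prob_space M"
    and "0 < p" and "p < 1"
    and "F \<in> F1_plus"
    and "\<And>n. random_cdf_F1_plus M (Fn n)"
    and "filterlim A at_top sequentially"
    and "tendsto_in_prob (completion M)
           (\<lambda>n \<omega>. real_of_ereal (quantile (Fn n \<omega>) p)) (real_of_ereal (quantile F p))"
    and "bounded_in_prob (completion M) (\<lambda>n \<omega>. A n * (SUP x. \<bar>Fn n \<omega> x - F x\<bar>))"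
  shows "tendsto_in_prob (completion M)
           (\<lambda>n \<omega>.
              A n * ((LBINT u=ereal p..1. real_of_ereal (quantile (Fn n \<omega>) u))
                     - (LBINT u=ereal p..1. real_of_ereal (quantile F u)))
              - A n * (LBINT x=quantile F p..\<infinity>. F x - Fn n \<omega> x)) 0
         \<and> (\<forall>(N :: 'b measure) L.
              prob_space N \<longrightarrow> L \<in> borel_measurable N \<longrightarrow>
              (tendsto_in_distr (completion M)
                 (\<lambda>n \<omega>. A n * ((LBINT u=ereal p..1. real_of_ereal (quantile (Fn n \<omega>) u))
                               - (LBINT u=ereal p..1. real_of_ereal (quantile F u)))) N L
               \<longleftrightarrow>
               tendsto_in_distr (completion M)
                 (\<lambda>n \<omega>. A n * ((LBINT x=quantile F p..\<infinity>. 1 - Fn n \<omega> x)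
                               - (LBINT x=quantile F p..\<infinity>. 1 - F x))) N L))"
proof -
  define q where "q = rquantile F p"
  have Fc: "is_cdf F" and q_eq: "quantile F p = ereal q"
    using F1_plusD[OF assms(4,2,3)] ereal_rquantile[of F p] assms(2,3) by (auto simp: q_def)
  have joint: "(\<lambda>(\<omega>, x). Fn n \<omega> x) \<in> borel_measurable (completion M \<Otimes>\<^sub>M borel)" for n
    using assms(5)[of n] borel_measurable_pair_completion unfolding random_cdf_F1_plus_def by blast
  have AE_Fn: "AE \<omega> in completion M. Fn n \<omega> \<in> F1_plus" for n
    using assms(5)[of n] by (intro AE_completion) (simp add: random_cdf_F1_plus_def)
  have quantile_int: "(LBINT u=ereal p..1. f u) = (LBINT u:{p<..<1}. f u)" for f :: "real \<Rightarrow> real"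
    using assms(3) by (simp add: interval_lebesgue_integral_le_eq one_ereal_def)

  define I where "I = (\<lambda>n \<omega>. (LBINT u=ereal p..1. rquantile (Fn n \<omega>) u))"
  define I0 where "I0 = (LBINT u=ereal p..1. rquantile F u)"
  define J where "J = (\<lambda>n \<omega>. (LBINT x=quantile F p..\<infinity>. 1 - Fn n \<omega> x))"
  define J0 where "J0 = (LBINT x=quantile F p..\<infinity>. 1 - F x)"
  define H where "H = (\<lambda>n \<omega>. (LBINT x=quantile F p..\<infinity>. F x - Fn n \<omega> x))"
  have q_meas [measurable]: "(\<lambda>\<omega>. rquantile (Fn n \<omega>) p) \<in> borel_measurable (completion M)" for n
    using assms(7) by (simp add: tendsto_in_prob_def)
  have J_meas [measurable]: "J n \<in> borel_measurable (completion M)" for n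
    using borel_measurable_cdf_tail[OF joint[of n], of "\<lambda>_. q"]
    by (simp add: J_def q_eq interval_integral_to_infinity_eq)
  \<comment> \<open>Almost surely the tail identity rewrites \<open>I n\<close> through the single
    quantile at \<open>p\<close>, measurable by the convergence hypothesis, and a tail integral with
    random left endpoint. This avoids joint measurability of the quantile function.\<close>
  have I_meas [measurable]: "I n \<in> borel_measurable (completion M)" for n
  proof (rule completion.borel_measurable_cong_AE)
    show "(\<lambda>\<omega>. (1 - p) * rquantile (Fn n \<omega>) p
        + (LBINT x:{rquantile (Fn n \<omega>) p<..}. 1 - Fn n \<omega> x)) \<in> borel_measurable (completion M)"
      by (intro borel_measurable_add borel_measurable_times borel_measurable_const q_meas
          borel_measurable_cdf_tail joint)
    show "AE \<omega> in completion M. (1 - p) * rquantile (Fn n \<omega>) p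
        + (LBINT x:{rquantile (Fn n \<omega>) p<..}. 1 - Fn n \<omega> x) = I n \<omega>"
      using AE_Fn[of n]
      by eventually_elim
        (simp add: I_def quantile_int quantile_tail(2)[OF _ assms(2,3)] F1_plusD[OF _ assms(2,3)])
  qed
  have H_eq: "AE \<omega> in completion M. H n \<omega> = J n \<omega> - J0" for n
    using AE_Fn[of n]
  proof eventually_elim
    case (elim \<omega>)
    have "J n \<omega> - J0 = (LBINT x:{q<..}. (1 - Fn n \<omega> x) - (1 - F x))"
      unfolding J_def J0_def q_eq interval_integral_to_infinity_eq
      by (rule set_integral_diff(2)[symmetric]; rule set_integrable_cdf_tail; fact)
    then show ?case
      by (simp add: H_def q_eq interval_integral_to_infinity_eq)
  qed
  have H_meas [measurable]: "H n \<in> borel_measurable (completion M)" for n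
  proof (rule completion.borel_measurable_cong_AE)
    show "(\<lambda>\<omega>. J n \<omega> - J0) \<in> borel_measurable (completion M)" by measurable
    show "AE \<omega> in completion M. J n \<omega> - J0 = H n \<omega>"
      using H_eq[of n] by eventually_elim simp
  qed
  have bound: "AE \<omega> in completion M. \<bar>A n * (I n \<omega> - I0) - A n * (J n \<omega> - J0)\<bar>
      \<le> \<bar>rquantile (Fn n \<omega>) p - q\<bar> * \<bar>A n * (SUP x. \<bar>Fn n \<omega> x - F x\<bar>)\<bar>" for n
    using AE_Fn[of n]
  proof eventually_elim
    case (elim \<omega>)
    let ?S = "SUP x. \<bar>Fn n \<omega> x - F x\<bar>"
    \<comment> \<open>Boundedness is what makes the real-valued \<open>SUP\<close> a genuine upper
      bound.\<close>
    have "\<bar>Fn n \<omega> x - F x\<bar> \<le> 1" for x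
      using is_cdf_range[OF Fc, of x] is_cdf_range[OF F1_plusD(1)[OF elim assms(2,3)], of x]
      by linarith
    then have S: "\<bar>Fn n \<omega> x - F x\<bar> \<le> ?S" for x
      by (intro cSUP_upper bdd_aboveI2[where M=1]) auto
    have "\<bar>(I n \<omega> - I0) - (J n \<omega> - J0)\<bar> \<le> \<bar>rquantile (Fn n \<omega>) p - q\<bar> * ?S"
      using quantile_integral_linearization[OF assms(4) elim assms(2,3) S]
      by (simp add: I_def I0_def J_def J0_def quantile_int q_eq interval_integral_to_infinity_eq
          flip: q_def)
    also have "\<dots> \<le> \<bar>rquantile (Fn n \<omega>) p - q\<bar> * \<bar>?S\<bar>"
      by (intro mult_left_mono) auto
    \<comment> \<open>The factor is \<open>\<bar>A n\<bar>\<close> because \<open>A n\<close> may be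
      negative for small \<open>n\<close>.\<close>
    finally have "\<bar>A n\<bar> * \<bar>(I n \<omega> - I0) - (J n \<omega> - J0)\<bar>
        \<le> \<bar>A n\<bar> * (\<bar>rquantile (Fn n \<omega>) p - q\<bar> * \<bar>?S\<bar>)"
      by (intro mult_left_mono) auto
    then show ?case
      by (simp add: abs_mult mult.left_commute flip: right_diff_distrib)
  qed
  interpret C: prob_space "completion M"
    by (rule prob_space.prob_space_completion) fact
  note to_zero = tendsto_in_prob_mult_bounded[OF C.prob_space_axioms assms(7)[folded q_def] assms(8)]
  have IJ: "tendsto_in_prob (completion M) (\<lambda>n \<omega>. A n * (I n \<omega> - I0) - A n * (J n \<omega> - J0)) 0"
    by (rule to_zero[OF _ bound]) measurable
  \<comment> \<open>The Slutsky lemma transfers a limit in one direction only, so the equivalence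
    uses the difference with both signs.\<close>
  have JI: "tendsto_in_prob (completion M) (\<lambda>n \<omega>. A n * (J n \<omega> - J0) - A n * (I n \<omega> - I0)) 0"
  proof (rule to_zero)
    fix n show "AE \<omega> in completion M. \<bar>A n * (J n \<omega> - J0) - A n * (I n \<omega> - I0)\<bar>
      \<le> \<bar>rquantile (Fn n \<omega>) p - q\<bar> * \<bar>A n * (SUP x. \<bar>Fn n \<omega> x - F x\<bar>)\<bar>"
      using bound[of n] by eventually_elim (simp add: abs_minus_commute)
  qed measurable
  have IH: "tendsto_in_prob (completion M) (\<lambda>n \<omega>. A n * (I n \<omega> - I0) - A n * H n \<omega>) 0"
  proof (rule to_zero)
    fix n show "AE \<omega> in completion M. \<bar>A n * (I n \<omega> - I0) - A n * H n \<omega>\<bar>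
      \<le> \<bar>rquantile (Fn n \<omega>) p - q\<bar> * \<bar>A n * (SUP x. \<bar>Fn n \<omega> x - F x\<bar>)\<bar>"
      using bound[of n] H_eq[of n] by eventually_elim simp
  qed measurable
  have equiv: "tendsto_in_distr (completion M) (\<lambda>n \<omega>. A n * (I n \<omega> - I0)) N L
      \<longleftrightarrow> tendsto_in_distr (completion M) (\<lambda>n \<omega>. A n * (J n \<omega> - J0)) N L"
    if "prob_space N" "L \<in> borel_measurable N" for N :: "'b measure" and L
    using tendsto_in_distr_slutsky[OF C.prob_space_axioms that _ IJ]
      tendsto_in_distr_slutsky[OF C.prob_space_axioms that _ JI] by auto
  show ?thesis
    using IH equiv unfolding I_def I0_def J_def J0_def H_def by blast
qed

end
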